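(* Assume that the covariance matrix $C_k$ is non-singular for every $k\in\mathcal{K}$. Then the optimization problem $$\text{(A)}\qquad \min_{\bm{n}\ge\bm{0}}\ \bm{e}_1^T\Psi^\dagger(\bm{n})\bm{e}_1\quad\text{s.t.}\quad \bm{n}^T\bm{c}\le b,\quad \bm{n}^T\bm{h}\ge 1,$$ and the semidefinite program $$\text{(B)}\qquad \min_{t\in\mathbb{R},\ \bm{n}\ge\bm{0}}\ t\quad\text{s.t.}\quad \Phi(t,\bm{n})=\begin{bmatrix}\Psi(\bm{n}) & \bm{e}_1\\ \bm{e}_1^T & t\end{bmatrix}\succeq 0,\quad \bm{n}^T\bm{c}\le b,\quad \bm{n}^T\bm{h}\ge 1,$$ are equivalent. That is, the two problems have the same optimal value, and a vector $\bm{n}^*$ is an optimal solution of (A) if and only if there is a $t^*\in\mathbb{R}$ such that $(t^*,\bm{n}^* )$ is an optimal solution of (B).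
   Context: Let $\mathcal{M}=\{\mathcal{M}_1,\dots,\mathcal{M}_\ell\}$ be a set of $\ell$ models, $\mathcal{M}_1$ being the high-fidelity model; model $\mathcal{M}_i$ has as output a real random variable $p_i(\omega)$ of finite variance (all defined on a common probability space). Let $\mathcal{G}=\{\mathcal{G}_k\}_{k\in\mathcal{K}}\subseteq 2^{\mathcal{M}}\setminus\{\emptyset\}$, with $\mathcal{K}=\{1,\dots,|\mathcal{G}|\}$, be a given set of distinct nonempty model groups. For each $k\in\mathcal{K}$, let $\bm{p}^k=[p_i]_{\mathcal{M}_i\in\mathcal{G}_k}$ be the random vector of the outputs of the models in $\mathcal{G}_k$ (in increasing order of $i$), let $C_k=C(\bm{p}^k,\bm{p}^k)$ be its covariance matrix, and let $R_k\in\mathbb{R}^{|\mathcal{G}_k|\times\ell}$ be the boolean restriction matrix made of the rows of the $\ell\times\ell$ identity matrix with indices $i$ such that $\mathcal{M}_i\in\mathcal{G}_k$ (in the same order). For $\bm{n}=[n_k]_{k\in\mathcal{K}}\ge\bm{0}$ (entrywise), define $$\Psi(\bm{n})=\sum_{k\in\mathcal{K}} n_k\,R_k^T C_k^{-1}R_k\in\mathbb{R}^{\ell\times\ell},$$ and let $\Psi^\dagger(\bm{n})$ be its Moore-Penrose pseudo-inverse. Here $\bm{e}_1=[1,0,\dots,0]^T\in\mathbb{R}^\ell$; $\bm{c}\in\mathbb{R}^{|\mathcal{G}|}$ is the cost vector, $c_k$ being the cost of one sample of group $\mathcal{G}_k$; $b>0$ is the computational budget; and $\bm{h}\in\{0,1\}^{|\mathcal{G}|}$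 is defined by $h_k=1$ if and only if $\mathcal{M}_1\in\mathcal{G}_k$. $A\succeq 0$ means that the symmetric matrix $A$ is positive semi-definite. The variable $\bm{n}$ ranges over nonnegative real vectors in $\mathbb{R}^{|\mathcal{G}|}$ (continuous relaxation of integer sample numbers), in both problems. *)

theory Defs
  imports
    "HOL-Probability.Probability"
    "Jordan_Normal_Form.Gauss_Jordan_Elimination"
    "Jordan_Normal_Form.DL_Submatrix"
begin

text \<open>
  Indices are 0-based, as in \<^theory>\<open>Jordan_Normal_Form.Matrix\<close>: the models are the indices
  \<open>{..<l}\<close> with high-fidelity model \<open>0\<close>, the groups are \<open>G 0, \<dots>, G (K - 1)\<close> with
  \<open>G k \<subseteq> {..<l}\<close>, and the first unit vector is \<open>unit_vec l 0\<close>.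
\<close>

definition covariance :: "'a measure \<Rightarrow> ('a \<Rightarrow> real) \<Rightarrow> ('a \<Rightarrow> real) \<Rightarrow> real" where
  "covariance M X Y =
     (\<integral>\<omega>. (X \<omega> - integral\<^sup>L M X) * (Y \<omega> - integral\<^sup>L M Y) \<partial>M)"

definition covariance_mat :: "'a measure \<Rightarrow> nat \<Rightarrow> (nat \<Rightarrow> 'a \<Rightarrow> real) \<Rightarrow> real mat" where
  "covariance_mat M m X = mat m m (\<lambda>(i, j). covariance M (X i) (X j))"

text \<open>\<open>pick S i\<close> is the \<open>i\<close>-th smallest element of \<open>S\<close>, counted from \<open>0\<close>.\<close>

definition group_outputs :: "(nat \<Rightarrow> 'a \<Rightarrow> real) \<Rightarrow> nat set \<Rightarrow> nat \<Rightarrow> 'a \<Rightarrow> real" where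
  "group_outputs p S i = p (pick S i)"

definition group_cov :: "'a measure \<Rightarrow> (nat \<Rightarrow> 'a \<Rightarrow> real) \<Rightarrow> nat set \<Rightarrow> real mat" where
  "group_cov M p S = covariance_mat M (card S) (group_outputs p S)"

definition restriction_mat :: "nat \<Rightarrow> nat set \<Rightarrow> real mat" where
  "restriction_mat l S = submatrix (1\<^sub>m l) S UNIV"

text \<open>The sum over the groups is written entrywise: \<^typ>\<open>real mat\<close> contains matrices of all
  dimensions and hence is not an additive monoid. The value of \<^term>\<open>the (mat_inverse C)\<close> is
  meaningful only for invertible \<open>C\<close>.\<close>

definition Psi ::
  "'a measure \<Rightarrow> (nat \<Rightarrow> 'a \<Rightarrow> real) \<Rightarrow> nat \<Rightarrow> (nat \<Rightarrow> nat set) \<Rightarrow> nat \<Rightarrow> real vec \<Rightarrow> real mat" where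
  "Psi M p l G K n = mat l l (\<lambda>(i, j). \<Sum>k<K. vec_index n k *
     ((restriction_mat l (G k))\<^sup>T * the (mat_inverse (group_cov M p (G k)))
        * restriction_mat l (G k)) $$ (i, j))"

definition is_pseudo_inverse :: "real mat \<Rightarrow> real mat \<Rightarrow> bool" where
  "is_pseudo_inverse A X \<longleftrightarrow>
     X \<in> carrier_mat (dim_col A) (dim_row A) \<and>
     A * X * A = A \<and> X * A * X = X \<and> (A * X)\<^sup>T = A * X \<and> (X * A)\<^sup>T = X * A"

lemma is_pseudo_inverse_unique:
  assumes "is_pseudo_inverse A X" "is_pseudo_inverse A Y"
  shows "X = Y"
proof -
  define r c where "r = dim_row A" and "c = dim_col A"
  have A: "A \<in> carrier_mat r c" and X: "X \<in> carrier_mat c r" and Y: "Y \<in> carrier_mat c r"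
    using assms by (auto simp: is_pseudo_inverse_def r_def c_def)
  have x: "A * X * A = A" "X * A * X = X" "(A * X)\<^sup>T = A * X" "(X * A)\<^sup>T = X * A"
    and y: "A * Y * A = A" "Y * A * Y = Y" "(A * Y)\<^sup>T = A * Y" "(Y * A)\<^sup>T = Y * A"
    using assms by (auto simp: is_pseudo_inverse_def)
  note c = A X Y mult_carrier_mat[OF A X] mult_carrier_mat[OF A Y]
    mult_carrier_mat[OF X A] mult_carrier_mat[OF Y A]
  have "A * X = (A * Y) * (A * X)"
    using y(1) assoc_mult_mat[OF c(5) A X] by simp
  also have "\<dots> = ((A * X) * (A * Y))\<^sup>T"
    using transpose_mult[OF c(4) c(5)] x(3) y(3) by simp
  also have "(A * X) * (A * Y) = A * Y"
    using x(1) assoc_mult_mat[OF c(4) A Y] by simp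
  finally have AX: "A * X = A * Y" using y(3) by simp
  have "X * A = (X * A) * (Y * A)"
    using y(1) assoc_mult_mat[OF X A c(7)] assoc_mult_mat[OF A Y A] by simp
  also have "\<dots> = ((Y * A) * (X * A))\<^sup>T"
    using transpose_mult[OF c(7) c(6)] x(4) y(4) by simp
  also have "(Y * A) * (X * A) = Y * A"
    using x(1) assoc_mult_mat[OF Y A c(6)] assoc_mult_mat[OF A X A] by simp
  finally have XA: "X * A = Y * A" using y(4) by simp
  show ?thesis
    using x(2) y(2) XA AX assoc_mult_mat[OF Y A X] assoc_mult_mat[OF Y A Y] by simp
qed

definition pseudo_inverse :: "real mat \<Rightarrow> real mat" where
  "pseudo_inverse A = (THE X. is_pseudo_inverse A X)"

definition psd_mat :: "real mat \<Rightarrow> bool" where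
  "psd_mat A \<longleftrightarrow> square_mat A \<and> A\<^sup>T = A \<and>
     (\<forall>x \<in> carrier_vec (dim_row A). scalar_prod x (A *\<^sub>v x) \<ge> 0)"

definition Phi ::
  "'a measure \<Rightarrow> (nat \<Rightarrow> 'a \<Rightarrow> real) \<Rightarrow> nat \<Rightarrow> (nat \<Rightarrow> nat set) \<Rightarrow> nat \<Rightarrow> real \<Rightarrow> real vec \<Rightarrow> real mat"
  where
  "Phi M p l G K t n = four_block_mat
     (Psi M p l G K n)              (mat_of_cols l [unit_vec l 0])
     (mat_of_rows l [unit_vec l 0]) (mat 1 1 (\<lambda>_. t))"

definition hf_vec :: "(nat \<Rightarrow> nat set) \<Rightarrow> nat \<Rightarrow> real vec" where
  "hf_vec G K = vec K (\<lambda>k. if 0 \<in> G k then 1 else 0)"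

definition feasible_A :: "(nat \<Rightarrow> nat set) \<Rightarrow> nat \<Rightarrow> real vec \<Rightarrow> real \<Rightarrow> real vec set" where
  "feasible_A G K c b = {n \<in> carrier_vec K. 0\<^sub>v K \<le> n \<and>
     scalar_prod n c \<le> b \<and> scalar_prod n (hf_vec G K) \<ge> 1}"

definition objective_A ::
  "'a measure \<Rightarrow> (nat \<Rightarrow> 'a \<Rightarrow> real) \<Rightarrow> nat \<Rightarrow> (nat \<Rightarrow> nat set) \<Rightarrow> nat \<Rightarrow> real vec \<Rightarrow> real" where
  "objective_A M p l G K n =
     scalar_prod (unit_vec l 0) (pseudo_inverse (Psi M p l G K n) *\<^sub>v unit_vec l 0)"

definition feasible_B ::
  "'a measure \<Rightarrow> (nat \<Rightarrow> 'a \<Rightarrow> real) \<Rightarrow> nat \<Rightarrow> (nat \<Rightarrow> nat set) \<Rightarrow> nat \<Rightarrow> real vec \<Rightarrow> real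
     \<Rightarrow> (real \<times> real vec) set" where
  "feasible_B M p l G K c b = {(t, n). n \<in> carrier_vec K \<and> 0\<^sub>v K \<le> n \<and>
     psd_mat (Phi M p l G K t n) \<and>
     scalar_prod n c \<le> b \<and> scalar_prod n (hf_vec G K) \<ge> 1}"

end

theory Submission
  imports Defs
begin

text \<open>
  The second problem is the epigraph form of the first. For a fixed sample allocation \<open>n\<close> that
  satisfies the two linear constraints, \<open>\<Phi>(t, n)\<close> is positive semi-definite exactly when
  \<open>e\<^sub>1\<^sup>T \<Psi>\<^sup>\<dagger>(n) e\<^sub>1 \<le> t\<close> (lemma \<open>Phi_psd_iff\<close>). Hence the feasible pairs \<open>(t, n)\<close> are the points
  on or above the graph of the objective over the first feasible set, and minimizing the height \<open>t\<close>
  over an epigraph is the same as minimizing the function.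

  The equivalence is a Schur complement argument for a block \<open>\<Psi>\<close> that may be singular. It works
  because \<open>e\<^sub>1\<close> lies in the range of \<open>\<Psi>\<close>: if \<open>\<Psi> w = e\<^sub>1\<close>, completing the square gives
  \[ x^T \Psi x + 2 s\, x^T e_1 + s^2 t = (x + s w)^T \Psi (x + s w) + s^2 (t - w^T \Psi w), \]
  and \<open>w\<^sup>T \<Psi> w = (\<Psi> w)\<^sup>T \<Psi>\<^sup>\<dagger> (\<Psi> w)\<close> is the objective value.

  That \<open>e\<^sub>1\<close> is in the range is where the constraint \<open>n\<^sup>T h \<ge> 1\<close> enters (lemma
  \<open>unit_vec_in_range_Psi\<close>). It forces \<open>n\<^sub>k > 0\<close> for some group that contains the high-fidelity model.
  An invertible covariance matrix is positive definite, and so is its inverse; therefore a vector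
  \<open>x\<close> in the kernel of \<open>\<Psi>\<close> satisfies \<open>R\<^sub>k x = 0\<close> for this group, so its first coordinate vanishes.
  Thus \<open>e\<^sub>1\<close> is orthogonal to the kernel of the symmetric matrix \<open>\<Psi>\<close>, which means that it is in its
  range (lemma \<open>symmetric_system_solvable\<close>). The same solvability criterion also yields the existence
  of the pseudo-inverse of a symmetric matrix (lemma \<open>symmetric_has_pseudo_inverse\<close>).
\<close>

(* From here on, \<bullet> and $ denote the scalar product and the entries of vectors of arbitrary
   dimension, not the operations of the same name on Euclidean spaces. *)
unbundle no inner_syntax
unbundle no vec_syntax


section \<open>Linear systems and pseudo-inverses of symmetric matrices\<close>

lemma mult_mat_vec_in_carrier [simp]:
  "A \<in> carrier_mat r q \<Longrightarrow> A *\<^sub>v v \<in> carrier_vec r"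
  by (metis carrier_matD(1) carrier_vecI dim_mult_mat_vec)

lemma scalar_prod_self_eq_0:
  fixes x :: "real vec"
  assumes x: "x \<in> carrier_vec n" and 0: "x \<bullet> x = 0"
  shows "x = 0\<^sub>v n"
proof (rule eq_vecI)
  have "(\<Sum>i<n. x $ i * x $ i) = 0"
    using 0 x by (simp add: scalar_prod_def atLeast0LessThan)
  then have "\<forall>i\<in>{..<n}. x $ i * x $ i = 0"
    by (subst (asm) sum_nonneg_eq_0_iff) simp_all
  then show "x $ i = 0\<^sub>v n $ i" if "i < dim_vec (0\<^sub>v n)" for i
    using that by simp
qed (use x in simp)

definition leading_vecs :: "nat \<Rightarrow> nat \<Rightarrow> real vec set" where
  "leading_vecs q m = {z \<in> carrier_vec q. \<forall>j<q. m \<le> j \<longrightarrow> z $ j = 0}"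

lemma leading_vecs_carrier: "z \<in> leading_vecs q m \<Longrightarrow> z \<in> carrier_vec q"
  by (simp add: leading_vecs_def)

lemma leading_vecs_full: "leading_vecs q q = carrier_vec q"
  by (auto simp: leading_vecs_def)

text \<open>
  The closest point to \<open>b\<close> in the span of the first \<open>m\<close> columns of \<open>A\<close>, built by the
  Gram-Schmidt step: the new column \<open>A e\<close> is first made orthogonal to the old span, which is the
  induction hypothesis for \<open>b = A e\<close>, and then the residual of \<open>b\<close> is corrected along the resulting
  direction \<open>u\<close>.
\<close>

lemma least_squares_on_leading_vecs:
  fixes A :: "real mat"
  assumes A: "A \<in> carrier_mat r q" and "m \<le> q" and "b \<in> carrier_vec r"
  shows "\<exists>y\<in>leading_vecs q m. \<forall>z\<in>leading_vecs q m. (A *\<^sub>v z) \<bullet> (b - A *\<^sub>v y) = 0"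
  using assms(2,3)
proof (induction m arbitrary: b)
  case 0
  have "z = 0\<^sub>v q" if "z \<in> leading_vecs q 0" for z
    using that by (intro eq_vecI) (auto simp: leading_vecs_def)
  then have "leading_vecs q 0 = {0\<^sub>v q}" by (auto simp: leading_vecs_def)
  moreover have A0: "A *\<^sub>v 0\<^sub>v q = 0\<^sub>v r" using A by (intro eq_vecI) auto
  moreover have "b - 0\<^sub>v r \<in> carrier_vec r" using 0 by simp
  ultimately show ?case by simp
next
  case (Suc m)
  define e :: "real vec" where "e = unit_vec q m"
  have m: "m < q" using Suc.prems(1) by simp
  have e: "e \<in> carrier_vec q" by (simp add: e_def)
  have Ae: "A *\<^sub>v e \<in> carrier_vec r" using A by simp
  obtain w where w: "w \<in> leading_vecs q m"
    and w_orth: "\<forall>z\<in>leading_vecs q m. (A *\<^sub>v z) \<bullet> (A *\<^sub>v e - A *\<^sub>v w) = 0"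
    using Suc.IH[OF less_imp_le[OF m] Ae] by blast
  obtain y where y: "y \<in> leading_vecs q m"
    and y_orth: "\<forall>z\<in>leading_vecs q m. (A *\<^sub>v z) \<bullet> (b - A *\<^sub>v y) = 0"
    using Suc.IH[OF less_imp_le[OF m] Suc.prems(2)] by blast
  note wc = leading_vecs_carrier[OF w] and yc = leading_vecs_carrier[OF y]
  define f where "f = e - w"
  have f: "f \<in> carrier_vec q" using e wc by (simp add: f_def)
  define u where "u = A *\<^sub>v f"
  have u: "u \<in> carrier_vec r" using A by (simp add: u_def)
  have u_eq: "u = A *\<^sub>v e - A *\<^sub>v w"
    unfolding u_def f_def by (rule mult_minus_distrib_mat_vec[OF A e wc])
  define res where "res = b - A *\<^sub>v y"
  have Ay: "A *\<^sub>v y \<in> carrier_vec r" using A by simp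
  have res: "res \<in> carrier_vec r" using Ay Suc.prems(2) by (simp add: res_def)
  (* If u = 0, the quotient is 0 by convention, and there is nothing to correct. *)
  define a where "a = (u \<bullet> res) / (u \<bullet> u)"
  have au: "a \<cdot>\<^sub>v u \<in> carrier_vec r" using u by simp
  define y' where "y' = y + a \<cdot>\<^sub>v f"
  have "A *\<^sub>v y' = A *\<^sub>v y + a \<cdot>\<^sub>v u"
    using mult_add_distrib_mat_vec[OF A yc, of "a \<cdot>\<^sub>v f"] mult_mat_vec[OF A f] f
    by (simp add: y'_def u_def)
  then have res': "b - A *\<^sub>v y' = res - a \<cdot>\<^sub>v u"
    using A Ay u Suc.prems(2) by (intro eq_vecI) (simp_all add: res_def)
  have ur: "u \<bullet> (res - a \<cdot>\<^sub>v u) = 0"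
  proof (cases "u \<bullet> u = 0")
    case True
    then have "u = 0\<^sub>v r" using scalar_prod_self_eq_0[OF u] by simp
    then show ?thesis using res au by simp
  next
    case False
    then show ?thesis using u scalar_prod_minus_distrib[OF u res au] by (simp add: a_def)
  qed
  have "(A *\<^sub>v z) \<bullet> (res - a \<cdot>\<^sub>v u) = 0" if z: "z \<in> leading_vecs q (Suc m)" for z
  proof -
    note zc = leading_vecs_carrier[OF z]
    define z' where "z' = z - (z $ m) \<cdot>\<^sub>v f"
    have z'c: "z' \<in> carrier_vec q" using zc f by (simp add: z'_def)
    have "z' $ j = 0" if j: "j < q" "m \<le> j" for j
    proof (cases "j = m")
      case True
      then show ?thesis using j w zc wc by (simp add: z'_def f_def e_def leading_vecs_def)
    next
      case False
      then have "z $ j = 0" "w $ j = 0" using j w z by (auto simp: leading_vecs_def)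
      then show ?thesis using False j zc wc by (simp add: z'_def f_def e_def)
    qed
    then have z': "z' \<in> leading_vecs q m" using z'c by (simp add: leading_vecs_def)
    have Az': "A *\<^sub>v z' \<in> carrier_vec r" using A by simp
    have zu: "(z $ m) \<cdot>\<^sub>v u \<in> carrier_vec r" using u by simp
    have "z = z' + (z $ m) \<cdot>\<^sub>v f" using zc f by (intro eq_vecI) (simp_all add: z'_def)
    then have "A *\<^sub>v z = A *\<^sub>v z' + (z $ m) \<cdot>\<^sub>v u"
      using mult_add_distrib_mat_vec[OF A z'c, of "(z $ m) \<cdot>\<^sub>v f"] mult_mat_vec[OF A f] f
      by (metis smult_carrier_vec u_def)
    then have "(A *\<^sub>v z) \<bullet> (res - a \<cdot>\<^sub>v u) =
        (A *\<^sub>v z') \<bullet> (res - a \<cdot>\<^sub>v u) + (z $ m) * (u \<bullet> (res - a \<cdot>\<^sub>v u))"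
      using add_scalar_prod_distrib[OF Az' zu, of "res - a \<cdot>\<^sub>v u"] u res au by simp
    also have "(A *\<^sub>v z') \<bullet> (res - a \<cdot>\<^sub>v u) = 0"
      using scalar_prod_minus_distrib[OF Az' res au] u Az' w_orth y_orth z'
      by (simp add: u_eq[symmetric] res_def)
    finally show ?thesis by (simp add: ur)
  qed
  moreover have "y' \<in> leading_vecs q (Suc m)"
    using y w by (auto simp: y'_def f_def e_def leading_vecs_def)
  ultimately show ?case using res' by (intro bexI[of _ y'] ballI) simp_all
qed

lemma symmetric_scalar_prod_mult:
  fixes A :: "real mat"
  assumes "A \<in> carrier_mat n n" "A\<^sup>T = A" "x \<in> carrier_vec n" "y \<in> carrier_vec n"
  shows "(A *\<^sub>v x) \<bullet> y = x \<bullet> (A *\<^sub>v y)"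
  using transpose_vec_mult_scalar[of A n n y x] assms by simp

text \<open>
  The residual \<open>s\<close> of a least-squares solution is orthogonal to the range of \<open>A\<close>, hence, by symmetry,
  in the kernel of \<open>A\<close>. So \<open>s\<close> is orthogonal both to \<open>b\<close> and to \<open>A y\<close>, and therefore to itself.
\<close>

lemma symmetric_system_solvable:
  fixes A :: "real mat"
  assumes A: "A \<in> carrier_mat n n" and sym: "A\<^sup>T = A" and b: "b \<in> carrier_vec n"
    and orth: "\<And>x. x \<in> carrier_vec n \<Longrightarrow> A *\<^sub>v x = 0\<^sub>v n \<Longrightarrow> b \<bullet> x = 0"
  shows "\<exists>y\<in>carrier_vec n. A *\<^sub>v y = b"
proof -
  obtain y where y: "y \<in> carrier_vec n"
    and y_orth: "\<And>z. z \<in> carrier_vec n \<Longrightarrow> (A *\<^sub>v z) \<bullet> (b - A *\<^sub>v y) = 0"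
    using least_squares_on_leading_vecs[OF A le_refl b] unfolding leading_vecs_full by blast
  define s where "s = b - A *\<^sub>v y"
  have s: "s \<in> carrier_vec n" using A b by (simp add: s_def)
  have As: "A *\<^sub>v s \<in> carrier_vec n" using A by simp
  have "(A *\<^sub>v s) \<bullet> (A *\<^sub>v s) = 0"
    using symmetric_scalar_prod_mult[OF A sym As s] y_orth[OF As] by (simp add: s_def)
  then have "A *\<^sub>v s = 0\<^sub>v n" using scalar_prod_self_eq_0 As by blast
  then have "b \<bullet> s = 0" using orth s by blast
  moreover have "(A *\<^sub>v y) \<bullet> s = 0" using y_orth[OF y] by (simp add: s_def)
  ultimately have "s \<bullet> s = 0"
    using b s A by (subst (1) s_def, subst minus_scalar_prod_distrib[of _ n]) auto
  then have "s = 0\<^sub>v n" using scalar_prod_self_eq_0 s by blast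
  moreover have "b = s + A *\<^sub>v y" using A b by (intro eq_vecI) (auto simp: s_def)
  ultimately show ?thesis using y A by (intro bexI[of _ y]) auto
qed

text \<open>
  \<open>A\<close> and \<open>A\<^sup>2\<close> have the same kernel, since \<open>\<parallel>A x\<parallel>\<^sup>2 = x\<^sup>T A\<^sup>2 x\<close>; so each column of \<open>A\<close>, being orthogonal to
  the kernel of \<open>A\<^sup>2\<close>, is in the range of \<open>A\<^sup>2\<close>.
\<close>

lemma symmetric_factor_through_square:
  fixes A :: "real mat"
  assumes A: "A \<in> carrier_mat n n" and sym: "A\<^sup>T = A"
  shows "\<exists>Y\<in>carrier_mat n n. A * A * Y = A"
proof -
  have AA: "A * A \<in> carrier_mat n n" and AA_sym: "(A * A)\<^sup>T = A * A"
    using A sym transpose_mult[OF A A] by auto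
  have "\<exists>y\<in>carrier_vec n. (A * A) *\<^sub>v y = col A j" if j: "j < n" for j
  proof (rule symmetric_system_solvable[OF AA AA_sym])
    show "col A j \<in> carrier_vec n" using A by auto
    fix x assume x: "x \<in> carrier_vec n" and AAx: "(A * A) *\<^sub>v x = 0\<^sub>v n"
    have Ax: "A *\<^sub>v x \<in> carrier_vec n" using A by simp
    have "(A *\<^sub>v x) \<bullet> (A *\<^sub>v x) = x \<bullet> ((A * A) *\<^sub>v x)"
      using symmetric_scalar_prod_mult[OF A sym x Ax] assoc_mult_mat_vec[OF A A x] by simp
    then have "A *\<^sub>v x = 0\<^sub>v n" using AAx x scalar_prod_self_eq_0 Ax by simp
    moreover have "row A j = col A j" using A sym j by (metis carrier_matD(1) col_transpose)
    ultimately show "col A j \<bullet> x = 0" using A j by (metis carrier_matD(1) index_mult_mat_vec index_zero_vec(1))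
  qed
  then obtain y where y: "\<And>j. j < n \<Longrightarrow> y j \<in> carrier_vec n \<and> (A * A) *\<^sub>v y j = col A j"
    by metis
  define Y where "Y = mat n n (\<lambda>(i, j). y j $ i)"
  have Y: "Y \<in> carrier_mat n n" by (simp add: Y_def)
  have "A * A * Y = A"
  proof (rule eq_matI)
    fix i j assume "i < dim_row A" "j < dim_col A"
    then have ij: "i < n" "j < n" using A by auto
    have "col Y j = y j" using y[OF ij(2)] ij by (intro eq_vecI) (auto simp: Y_def)
    then have "(B * Y) $$ (i, j) = (B *\<^sub>v y j) $ i" if "B \<in> carrier_mat n n" for B
      using that ij Y by auto
    from this[OF AA]
    show "(A * A * Y) $$ (i, j) = A $$ (i, j)" using y[OF ij(2)] ij A by simp
  qed (use A Y in auto)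
  then show ?thesis using Y by blast
qed

text \<open>
  With \<open>A\<^sup>2 Y = A\<close>, the matrix \<open>P = A Y = Y\<^sup>T A\<close> is the orthogonal projection onto the range of \<open>A\<close>, and
  \<open>X = Y\<^sup>T P\<close> inverts \<open>A\<close> on that range and vanishes on its orthogonal complement: \<open>A X = X A = P\<close>.
\<close>

lemma symmetric_has_pseudo_inverse:
  fixes A :: "real mat"
  assumes A: "A \<in> carrier_mat n n" and sym: "A\<^sup>T = A"
  shows "\<exists>X. is_pseudo_inverse A X"
proof -
  obtain Y where Y: "Y \<in> carrier_mat n n" and AAY: "A * A * Y = A"
    using symmetric_factor_through_square[OF A sym] by blast
  define Z where "Z = Y\<^sup>T"
  have Z: "Z \<in> carrier_mat n n" using Y by (simp add: Z_def)
  note assoc = assoc_mult_mat[of _ n n _ n _ n]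
  have "(A * A * Y)\<^sup>T = A" using AAY sym by simp
  then have ZAA: "Z * A * A = A"
    using transpose_mult[of "A * A" n n Y n] transpose_mult[OF A A] A Y Z sym
    by (simp add: Z_def assoc)
  define P where "P = A * Y"
  have P: "P \<in> carrier_mat n n" using A Y by (simp add: P_def)
  have "P = (Z * A * A) * Y" by (simp add: P_def ZAA)
  also have "\<dots> = Z * (A * A * Y)" using A Y Z by (simp add: assoc)
  finally have P': "P = Z * A" by (simp add: AAY)
  have P_sym: "P\<^sup>T = P"
    using transpose_mult[OF A Y] sym P' by (simp add: P_def Z_def)
  have PA: "P * A = A" using ZAA by (simp add: P')
  have AP: "A * P = A" using AAY A Y by (simp add: P_def assoc)
  define X where "X = Z * P"
  have X: "X \<in> carrier_mat n n" using Z P by (simp add: X_def)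
  have "X = (Z * A) * Y" using A Y Z by (simp add: X_def P_def assoc)
  then have "X = P * Y" by (simp only: P')
  then have "A * X = (A * P) * Y" using A P Y by (simp add: assoc)
  then have AX: "A * X = P" by (simp add: AP P_def[symmetric])
  have XA: "X * A = P" using A P Z by (simp add: X_def assoc PA) (simp add: P')
  have "P * P = (P * A) * Y" using A P Y by (simp add: assoc P_def[symmetric])
  then have "P * P = P" by (simp add: PA P_def[symmetric])
  then have PX: "X * P = X" using Z P by (simp add: X_def assoc)
  have "X * A * X = X * (A * X)" using X A by (simp add: assoc)
  then have "X * A * X = X" by (simp add: AX PX)
  then have "is_pseudo_inverse A X"
    unfolding is_pseudo_inverse_def using X A by (simp add: AX XA PA P_sym)
  then show ?thesis by blast
qed

lemma is_pseudo_inverse_pseudo_inverse: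
  fixes A :: "real mat"
  assumes "A \<in> carrier_mat n n" "A\<^sup>T = A"
  shows "is_pseudo_inverse A (pseudo_inverse A)"
  unfolding pseudo_inverse_def
  using symmetric_has_pseudo_inverse[OF assms] is_pseudo_inverse_unique by (metis theI)

lemma pseudo_inverse_quadratic_form:
  fixes A :: "real mat"
  assumes A: "A \<in> carrier_mat n n" and sym: "A\<^sup>T = A" and w: "w \<in> carrier_vec n"
  shows "(A *\<^sub>v w) \<bullet> (pseudo_inverse A *\<^sub>v (A *\<^sub>v w)) = w \<bullet> (A *\<^sub>v w)"
proof -
  let ?X = "pseudo_inverse A"
  have X: "?X \<in> carrier_mat n n" and AXA: "A * ?X * A = A"
    using is_pseudo_inverse_pseudo_inverse[OF A sym] A by (auto simp: is_pseudo_inverse_def)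
  have Aw: "A *\<^sub>v w \<in> carrier_vec n" using A by simp
  have XAw: "?X *\<^sub>v (A *\<^sub>v w) \<in> carrier_vec n" using X by simp
  have "(A *\<^sub>v w) \<bullet> (?X *\<^sub>v (A *\<^sub>v w)) = w \<bullet> (A *\<^sub>v (?X *\<^sub>v (A *\<^sub>v w)))"
    by (rule symmetric_scalar_prod_mult[OF A sym w XAw])
  also have "A *\<^sub>v (?X *\<^sub>v (A *\<^sub>v w)) = (A * ?X * A) *\<^sub>v w"
    using A X w Aw by (simp add: assoc_mult_mat_vec[of _ n n _ n])
  finally show ?thesis by (simp add: AXA)
qed

section \<open>Positive semi-definite matrices\<close>

lemma psd_matI:
  assumes "A \<in> carrier_mat n n" "A\<^sup>T = A"
    and "\<And>x. x \<in> carrier_vec n \<Longrightarrow> x \<bullet> (A *\<^sub>v x) \<ge> 0"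
  shows "psd_mat A"
  using assms by (simp add: psd_mat_def)

lemma psd_mat_sym: "psd_mat A \<Longrightarrow> A\<^sup>T = A"
  by (simp add: psd_mat_def)

lemma psd_matD: "psd_mat A \<Longrightarrow> A \<in> carrier_mat n n \<Longrightarrow> x \<in> carrier_vec n \<Longrightarrow> x \<bullet> (A *\<^sub>v x) \<ge> 0"
  by (auto simp: psd_mat_def)

lemma quadratic_form_add:
  fixes A :: "real mat"
  assumes A: "A \<in> carrier_mat n n" and sym: "A\<^sup>T = A"
    and x: "x \<in> carrier_vec n" and z: "z \<in> carrier_vec n"
  shows "(x + s \<cdot>\<^sub>v z) \<bullet> (A *\<^sub>v (x + s \<cdot>\<^sub>v z)) =
    x \<bullet> (A *\<^sub>v x) + 2 * s * (x \<bullet> (A *\<^sub>v z)) + s\<^sup>2 * (z \<bullet> (A *\<^sub>v z))"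
proof -
  have sz: "s \<cdot>\<^sub>v z \<in> carrier_vec n" using z by simp
  have Ax: "A *\<^sub>v x \<in> carrier_vec n" and Az: "A *\<^sub>v z \<in> carrier_vec n" using A by auto
  have "A *\<^sub>v (x + s \<cdot>\<^sub>v z) = A *\<^sub>v x + s \<cdot>\<^sub>v (A *\<^sub>v z)"
    using mult_add_distrib_mat_vec[OF A x sz] mult_mat_vec[OF A z] by simp
  moreover have "z \<bullet> (A *\<^sub>v x) = x \<bullet> (A *\<^sub>v z)"
    using symmetric_scalar_prod_mult[OF A sym z x] comm_scalar_prod[OF Az x] by simp
  ultimately show ?thesis
    using x z Ax Az
    by (simp add: add_scalar_prod_distrib[of _ n] scalar_prod_add_distrib[of _ n]
        power2_eq_square algebra_simps)
qed

text \<open>Near \<open>s = 0\<close> a nonzero linear term dominates and makes the polynomial negative on one side.\<close>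

lemma linear_term_zero_of_nonneg:
  fixes a d :: real
  assumes "\<And>s. 2 * s * a + s\<^sup>2 * d \<ge> 0"
  shows "a = 0"
proof (rule ccontr)
  assume a: "a \<noteq> 0"
  (* Close enough to 0 that the quadratic term is at most half of the linear one in absolute value. *)
  define s where "s = - a / (\<bar>d\<bar> + 1)"
  have eq: "s * (\<bar>d\<bar> + 1) = - a" by (simp add: s_def)
  have "s\<^sup>2 * d \<le> s\<^sup>2 * (\<bar>d\<bar> + 1)" by (intro mult_left_mono) auto
  also have "\<dots> = - (s * a)" using eq by (simp add: power2_eq_square mult.assoc)
  finally have "2 * s * a + s\<^sup>2 * d \<le> s * a" by linarith
  also have "s * a < 0"
  proof -
    have "s * a = - (a\<^sup>2 / (\<bar>d\<bar> + 1))" by (simp add: s_def power2_eq_square)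
    moreover have "a\<^sup>2 / (\<bar>d\<bar> + 1) > 0" using a by (intro divide_pos_pos) auto
    ultimately show ?thesis by linarith
  qed
  finally show False using assms[of s] by linarith
qed

text \<open>
  \<open>x\<close> minimizes the quadratic form, so the derivative of the form at \<open>x\<close> in the direction \<open>A x\<close>,
  which is \<open>2 \<parallel>A x\<parallel>\<^sup>2\<close>, vanishes.
\<close>

lemma psd_mat_kernel:
  assumes psd: "psd_mat A" and A: "A \<in> carrier_mat n n" and x: "x \<in> carrier_vec n"
    and 0: "x \<bullet> (A *\<^sub>v x) = 0"
  shows "A *\<^sub>v x = 0\<^sub>v n"
proof -
  let ?z = "A *\<^sub>v x"
  have z: "?z \<in> carrier_vec n" using A by simp
  have "2 * s * (x \<bullet> (A *\<^sub>v ?z)) + s\<^sup>2 * (?z \<bullet> (A *\<^sub>v ?z)) \<ge> 0" for s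
    using psd_matD[OF psd A, of "x + s \<cdot>\<^sub>v ?z"] x z
      quadratic_form_add[OF A psd_mat_sym[OF psd] x z, of s] 0 by simp
  then have "x \<bullet> (A *\<^sub>v ?z) = 0" by (rule linear_term_zero_of_nonneg)
  then have "?z \<bullet> ?z = 0"
    using symmetric_scalar_prod_mult[OF A psd_mat_sym[OF psd] x z] by simp
  then show ?thesis using scalar_prod_self_eq_0 z by blast
qed

lemma mat_inverse_of_invertible:
  fixes A :: "real mat"
  assumes A: "A \<in> carrier_mat n n" and inv: "invertible_mat A"
  shows "the (mat_inverse A) \<in> carrier_mat n n"
    and "A * the (mat_inverse A) = 1\<^sub>m n" and "the (mat_inverse A) * A = 1\<^sub>m n"
proof -
  obtain B where AB: "A * B = 1\<^sub>m n" and BA: "B * A = 1\<^sub>m (dim_row B)"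
    using inv A by (auto simp: invertible_mat_def inverts_mat_def)
  have "dim_col B = n" using arg_cong[OF AB, of dim_col] by simp
  moreover have "dim_row B = n" using arg_cong[OF BA, of dim_col] A by simp
  ultimately have B: "B \<in> carrier_mat n n" by auto
  have "A \<in> Units (ring_mat TYPE(real) n ())"
    unfolding Units_def using A B AB BA by (auto simp: ring_mat_simps intro!: bexI[of _ B])
  then obtain B' where "mat_inverse A = Some B'"
    using mat_inverse(1)[OF A, of "()"] by (cases "mat_inverse A") auto
  then show "the (mat_inverse A) \<in> carrier_mat n n"
    and "A * the (mat_inverse A) = 1\<^sub>m n" and "the (mat_inverse A) * A = 1\<^sub>m n"
    using mat_inverse(2)[OF A] by auto
qed

text \<open>With \<open>y = A\<^sup>-\<^sup>1 x\<close>, the form of the inverse at \<open>x\<close> is the form of \<open>A\<close> at \<open>y\<close>.\<close>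

lemma mat_inverse_psd:
  assumes psd: "psd_mat A" and A: "A \<in> carrier_mat n n" and inv: "invertible_mat A"
  shows "psd_mat (the (mat_inverse A))"
    and "\<And>x. x \<in> carrier_vec n \<Longrightarrow> x \<bullet> (the (mat_inverse A) *\<^sub>v x) = 0 \<Longrightarrow> x = 0\<^sub>v n"
proof -
  define B where "B = the (mat_inverse A)"
  have B: "B \<in> carrier_mat n n" and AB: "A * B = 1\<^sub>m n" and BA: "B * A = 1\<^sub>m n"
    using mat_inverse_of_invertible[OF A inv] by (auto simp: B_def)
  have sym: "A\<^sup>T = A" by (rule psd_mat_sym[OF psd])
  have BT: "B\<^sup>T \<in> carrier_mat n n" using B by simp
  have "B\<^sup>T = B\<^sup>T * (A * B)" using B AB by simp
  also have "\<dots> = (A * B)\<^sup>T * B"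
    using A B BT transpose_mult[OF A B] sym by (simp add: assoc_mult_mat[of _ n n _ n _ n])
  also have "\<dots> = B" using AB B by simp
  finally have B_sym: "B\<^sup>T = B" .
  have ABx: "A *\<^sub>v (B *\<^sub>v x) = x" if "x \<in> carrier_vec n" for x
    using assoc_mult_mat_vec[OF A B that] AB that by simp
  have form: "x \<bullet> (B *\<^sub>v x) = (B *\<^sub>v x) \<bullet> (A *\<^sub>v (B *\<^sub>v x))" if "x \<in> carrier_vec n" for x
    using ABx[OF that] comm_scalar_prod[OF that, of "B *\<^sub>v x"] B by simp
  show "psd_mat (the (mat_inverse A))"
    unfolding B_def[symmetric] psd_mat_def
    using B B_sym form psd_matD[OF psd A] by auto
  fix x assume x: "x \<in> carrier_vec n" and "x \<bullet> (the (mat_inverse A) *\<^sub>v x) = 0"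
  then have "(B *\<^sub>v x) \<bullet> (A *\<^sub>v (B *\<^sub>v x)) = 0" using form by (simp add: B_def)
  moreover have "B *\<^sub>v x \<in> carrier_vec n" using B by simp
  ultimately have "A *\<^sub>v (B *\<^sub>v x) = 0\<^sub>v n" using psd_mat_kernel[OF psd A] by blast
  then show "x = 0\<^sub>v n" using ABx[OF x] by simp
qed

text \<open>
  The Schur complement criterion in the form that also covers a singular block \<open>A\<close>: the off-diagonal
  column \<open>e\<close> only has to be in the range of \<open>A\<close>. Completing the square writes the form of the block
  matrix at \<open>(x, s)\<close> as the form of \<open>A\<close> at \<open>x + s w\<close> plus \<open>s\<^sup>2 (t - w\<^sup>T A w)\<close>.
\<close>

lemma psd_schur_complement:
  fixes A :: "real mat"
  assumes psd: "psd_mat A" and A: "A \<in> carrier_mat n n" and w: "w \<in> carrier_vec n"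
    and e: "A *\<^sub>v w = e"
  shows "psd_mat (four_block_mat A (mat_of_cols n [e]) (mat_of_rows n [e]) (mat 1 1 (\<lambda>_. t)))
    \<longleftrightarrow> w \<bullet> (A *\<^sub>v w) \<le> t" (is "psd_mat ?F \<longleftrightarrow> _")
proof -
  have sym: "A\<^sup>T = A" by (rule psd_mat_sym[OF psd])
  have ec: "e \<in> carrier_vec n" using A e by auto
  have C: "mat_of_cols n [e] \<in> carrier_mat n 1" and R: "mat_of_rows n [e] \<in> carrier_mat 1 n"
    and T: "mat 1 1 (\<lambda>_. t) \<in> carrier_mat 1 1"
    using mat_of_cols_carrier(1)[of n "[e]"] mat_of_rows_carrier(1)[of n "[e]"] by auto
  have F: "?F \<in> carrier_mat (n + 1) (n + 1)" using A T by (intro four_block_carrier_mat)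
  have "(mat 1 1 (\<lambda>_. t))\<^sup>T = mat 1 1 (\<lambda>_. t)" by (intro eq_matI) auto
  then have F_sym: "?F\<^sup>T = ?F"
    using transpose_four_block_mat[OF A C R T] sym by (simp add: transpose_mat_of_rows transpose_mat_of_cols)
  have form: "(x @\<^sub>v vec 1 (\<lambda>_. s)) \<bullet> (?F *\<^sub>v (x @\<^sub>v vec 1 (\<lambda>_. s))) =
      (x + s \<cdot>\<^sub>v w) \<bullet> (A *\<^sub>v (x + s \<cdot>\<^sub>v w)) + s\<^sup>2 * (t - w \<bullet> (A *\<^sub>v w))"
    if x: "x \<in> carrier_vec n" for x s
  proof -
    have "?F *\<^sub>v (x @\<^sub>v vec 1 (\<lambda>_. s)) = (A *\<^sub>v x + s \<cdot>\<^sub>v e) @\<^sub>v vec 1 (\<lambda>_. e \<bullet> x + t * s)"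
    proof (subst four_block_mat_mult_vec[OF A C R T x], simp, rule arg_cong2[where f = append_vec])
      show "A *\<^sub>v x + mat_of_cols n [e] *\<^sub>v vec 1 (\<lambda>_. s) = A *\<^sub>v x + s \<cdot>\<^sub>v e"
        using A ec by (intro eq_vecI) (auto simp: scalar_prod_def mat_of_cols_index)
      show "mat_of_rows n [e] *\<^sub>v x + mat 1 1 (\<lambda>_. t) *\<^sub>v vec 1 (\<lambda>_. s) = vec 1 (\<lambda>_. e \<bullet> x + t * s)"
        using ec by (intro eq_vecI) (auto simp: scalar_prod_def)
    qed
    then have "(x @\<^sub>v vec 1 (\<lambda>_. s)) \<bullet> (?F *\<^sub>v (x @\<^sub>v vec 1 (\<lambda>_. s))) =
        x \<bullet> (A *\<^sub>v x + s \<cdot>\<^sub>v e) + s * (e \<bullet> x + t * s)"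
      using x ec A by (simp add: scalar_prod_append[of _ n _ 1]) (simp add: scalar_prod_def)
    also have "\<dots> = x \<bullet> (A *\<^sub>v x) + 2 * s * (x \<bullet> e) + s\<^sup>2 * t"
      using x ec A comm_scalar_prod[OF x ec]
      by (simp add: scalar_prod_add_distrib[of _ n] power2_eq_square algebra_simps)
    finally show ?thesis
      using quadratic_form_add[OF A sym x w, of s] by (simp add: e algebra_simps)
  qed
  show ?thesis
  proof
    assume "psd_mat ?F"
    (* At (- w, 1) the first square vanishes and only t - w^T A w is left. *)
    have "(- 1 \<cdot>\<^sub>v w) @\<^sub>v vec 1 (\<lambda>_. 1 :: real) \<in> carrier_vec (n + 1)"
      using w by (intro append_carrier_vec) auto
    from psd_matD[OF \<open>psd_mat ?F\<close> F this]
    have "0 \<le> ((- 1 \<cdot>\<^sub>v w) @\<^sub>v vec 1 (\<lambda>_. 1)) \<bullet> (?F *\<^sub>v ((- 1 \<cdot>\<^sub>v w) @\<^sub>v vec 1 (\<lambda>_. 1)))" .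
    moreover have "- 1 \<cdot>\<^sub>v w + 1 \<cdot>\<^sub>v w = 0\<^sub>v n" using w by (intro eq_vecI) auto
    moreover have "0\<^sub>v n \<bullet> (A *\<^sub>v 0\<^sub>v n) = 0" using A by simp
    ultimately show "w \<bullet> (A *\<^sub>v w) \<le> t" using form[of "- 1 \<cdot>\<^sub>v w" 1] w by simp
  next
    assume t: "w \<bullet> (A *\<^sub>v w) \<le> t"
    have "v \<bullet> (?F *\<^sub>v v) \<ge> 0" if v: "v \<in> carrier_vec (n + 1)" for v
    proof -
      define x s where "x = vec_first v n" and "s = v $ n"
      have "v = x @\<^sub>v vec 1 (\<lambda>_. s)"
        using v by (intro eq_vecI) (auto simp: x_def s_def vec_first_def less_Suc_eq)
      moreover have "x \<in> carrier_vec n" by (simp add: x_def)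
      moreover have "(x + s \<cdot>\<^sub>v w) \<bullet> (A *\<^sub>v (x + s \<cdot>\<^sub>v w)) \<ge> 0"
        using psd_matD[OF psd A] w by (simp add: x_def)
      moreover have "s\<^sup>2 * (t - w \<bullet> (A *\<^sub>v w)) \<ge> 0" using t by simp
      ultimately show ?thesis using form by simp
    qed
    then show "psd_mat ?F" using F F_sym by (intro psd_matI)
  qed
qed

section \<open>Covariance matrices\<close>

lemma (in prob_space) integrable_mult_of_square_integrable:
  fixes X Y :: "'a \<Rightarrow> real"
  assumes [measurable]: "X \<in> borel_measurable M" "Y \<in> borel_measurable M"
    and "integrable M (\<lambda>\<omega>. (X \<omega>)\<^sup>2)" "integrable M (\<lambda>\<omega>. (Y \<omega>)\<^sup>2)"
  shows "integrable M (\<lambda>\<omega>. X \<omega> * Y \<omega>)"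
proof (rule Bochner_Integration.integrable_bound)
  show "integrable M (\<lambda>\<omega>. (X \<omega>)\<^sup>2 + (Y \<omega>)\<^sup>2)" using assms by simp
  have "\<bar>x * y\<bar> \<le> x\<^sup>2 + y\<^sup>2" for x y :: real
  proof -
    have "2 * \<bar>x * y\<bar> \<le> x\<^sup>2 + y\<^sup>2"
      using zero_le_power2[of "\<bar>x\<bar> - \<bar>y\<bar>"] by (simp add: power2_diff abs_mult)
    then show ?thesis using abs_ge_zero[of "x * y"] by linarith
  qed
  then show "AE \<omega> in M. norm (X \<omega> * Y \<omega>) \<le> norm ((X \<omega>)\<^sup>2 + (Y \<omega>)\<^sup>2)" by simp
qed simp

lemma mat_quadratic_form:
  fixes f :: "nat \<Rightarrow> nat \<Rightarrow> real"
  assumes "x \<in> carrier_vec m"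
  shows "x \<bullet> (mat m m (\<lambda>(i, j). f i j) *\<^sub>v x) = (\<Sum>i<m. \<Sum>j<m. x $ i * x $ j * f i j)"
  using assms
  by (simp add: scalar_prod_def sum_distrib_left atLeast0LessThan mult_ac)

text \<open>The quadratic form at \<open>x\<close> is the variance of \<open>\<Sum>i. x\<^sub>i X\<^sub>i\<close>.\<close>

lemma (in prob_space) psd_covariance_mat:
  assumes meas: "\<And>i. i < m \<Longrightarrow> X i \<in> borel_measurable M"
    and sq: "\<And>i. i < m \<Longrightarrow> integrable M (\<lambda>\<omega>. (X i \<omega>)\<^sup>2)"
  shows "psd_mat (covariance_mat M m X)"
proof -
  define Y where "Y i \<omega> = X i \<omega> - expectation (X i)" for i \<omega>
  have [measurable]: "Y i \<in> borel_measurable M" if "i < m" for i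
    using meas[OF that] by (simp add: Y_def[abs_def])
  have "integrable M (\<lambda>\<omega>. (Y i \<omega>)\<^sup>2)" if "i < m" for i
    using square_integrable_imp_integrable[OF meas[OF that] sq[OF that]] sq[OF that]
    by (simp add: Y_def power2_diff)
  then have int: "integrable M (\<lambda>\<omega>. Y i \<omega> * Y j \<omega>)" if "i < m" "j < m" for i j
    using that by (intro integrable_mult_of_square_integrable) auto
  have cov: "covariance M (X i) (X j) = expectation (\<lambda>\<omega>. Y i \<omega> * Y j \<omega>)" for i j
    by (simp add: covariance_def Y_def)
  have "x \<bullet> (covariance_mat M m X *\<^sub>v x) \<ge> 0" if x: "x \<in> carrier_vec m" for x
  proof -
    have "x \<bullet> (covariance_mat M m X *\<^sub>v x) =
        (\<Sum>i<m. \<Sum>j<m. expectation (\<lambda>\<omega>. x $ i * x $ j * (Y i \<omega> * Y j \<omega>)))"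
      unfolding covariance_mat_def mat_quadratic_form[OF x] by (simp add: cov)
    also have "\<dots> = (\<Sum>i<m. expectation (\<lambda>\<omega>. \<Sum>j<m. x $ i * x $ j * (Y i \<omega> * Y j \<omega>)))"
      using int by (intro sum.cong refl Bochner_Integration.integral_sum[symmetric]) auto
    also have "\<dots> = expectation (\<lambda>\<omega>. \<Sum>i<m. \<Sum>j<m. x $ i * x $ j * (Y i \<omega> * Y j \<omega>))"
      using int by (intro Bochner_Integration.integral_sum[symmetric] Bochner_Integration.integrable_sum
        integrable_mult_right) auto
    also have "\<dots> = expectation (\<lambda>\<omega>. (\<Sum>i<m. x $ i * Y i \<omega>)\<^sup>2)"
      by (simp add: power2_eq_square sum_product mult_ac)
    also have "\<dots> \<ge> 0" by simp
    finally show ?thesis .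
  qed
  moreover have "(covariance_mat M m X)\<^sup>T = covariance_mat M m X"
    by (intro eq_matI) (auto simp: covariance_mat_def cov mult.commute)
  ultimately show ?thesis by (auto simp: psd_mat_def covariance_mat_def)
qed

lemma (in prob_space) psd_group_cov:
  assumes "S \<subseteq> {..<l}"
    and "\<And>i. i < l \<Longrightarrow> p i \<in> borel_measurable M"
    and "\<And>i. i < l \<Longrightarrow> integrable M (\<lambda>\<omega>. (p i \<omega>)\<^sup>2)"
  shows "psd_mat (group_cov M p S)"
proof -
  have "pick S i < l" if "i < card S" for i
    using pick_in_set_le[OF that] assms(1) by auto
  then show ?thesis
    unfolding group_cov_def using assms by (intro psd_covariance_mat) (auto simp: group_outputs_def)
qed

section \<open>The information matrix of the sample allocation\<close>

lemma restriction_mat_carrier: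
  assumes "S \<subseteq> {..<l}"
  shows "restriction_mat l S \<in> carrier_mat (card S) l"
proof -
  have "{i. i < l \<and> i \<in> S} = S" using assms by auto
  then show ?thesis
    by (intro carrier_matI) (simp_all add: restriction_mat_def dim_submatrix)
qed

text \<open>Each \<open>i \<in> S\<close> is the \<open>j\<close>-th element of \<open>S\<close> for some \<open>j\<close>, and row \<open>j\<close> of the matrix selects entry \<open>i\<close>.\<close>

lemma restriction_mat_mult_vec_eq_0:
  assumes S: "S \<subseteq> {..<l}" and x: "x \<in> carrier_vec l"
    and 0: "restriction_mat l S *\<^sub>v x = 0\<^sub>v (card S)" and i: "i \<in> S"
  shows "x $ i = 0"
proof -
  have S': "{i. i < l \<and> i \<in> S} = S" using S by auto
  have il: "i < l" and fin: "finite S" using S i finite_subset by auto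
  define j where "j = card {a \<in> S. a < i}"
  have j: "j < card S" unfolding j_def using i fin by (intro psubset_card_mono) auto
  have pick: "pick S j = i" unfolding j_def by (rule pick_card_in_set[OF i])
  note R = restriction_mat_carrier[OF S]
  have "row (restriction_mat l S) j = unit_vec l i"
    using R j pick il S' by (intro eq_vecI)
      (auto simp: restriction_mat_def submatrix_index pick_UNIV)
  then have "(restriction_mat l S *\<^sub>v x) $ j = x $ i" using R j x il by simp
  then show ?thesis using 0 j by simp
qed

lemma Psi_carrier: "Psi M p l G K n \<in> carrier_mat l l"
  by (simp add: Psi_def)

lemma congruence_carrier:
  assumes "R \<in> carrier_mat m l" "B \<in> carrier_mat m m"
  shows "R\<^sup>T * B * R \<in> carrier_mat l l"
  using assms by auto

lemma congruence_quadratic_form: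
  fixes R B :: "real mat"
  assumes R: "R \<in> carrier_mat m l" and B: "B \<in> carrier_mat m m" and x: "x \<in> carrier_vec l"
  shows "x \<bullet> ((R\<^sup>T * B * R) *\<^sub>v x) = (R *\<^sub>v x) \<bullet> (B *\<^sub>v (R *\<^sub>v x))"
proof -
  have RT: "R\<^sup>T \<in> carrier_mat l m" using R by simp
  have Rx: "R *\<^sub>v x \<in> carrier_vec m" using R by simp
  have y: "B *\<^sub>v (R *\<^sub>v x) \<in> carrier_vec m" using B by simp
  have "(R\<^sup>T * B * R) *\<^sub>v x = R\<^sup>T *\<^sub>v (B *\<^sub>v (R *\<^sub>v x))"
    using assoc_mult_mat_vec[OF mult_carrier_mat[OF RT B] R x] assoc_mult_mat_vec[OF RT B Rx] by simp
  moreover have "x \<bullet> (R\<^sup>T *\<^sub>v (B *\<^sub>v (R *\<^sub>v x))) = (R\<^sup>T *\<^sub>v (B *\<^sub>v (R *\<^sub>v x))) \<bullet> x"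
    using RT x by (intro comm_scalar_prod[of _ l]) auto
  moreover have "\<dots> = (B *\<^sub>v (R *\<^sub>v x)) \<bullet> (R *\<^sub>v x)"
    by (rule transpose_vec_mult_scalar[OF R x y])
  ultimately show ?thesis using comm_scalar_prod[OF Rx y] by simp
qed

locale model_groups = prob_space M for M :: "'a measure" +
  fixes p :: "nat \<Rightarrow> 'a \<Rightarrow> real" and l K :: nat and G :: "nat \<Rightarrow> nat set"
  assumes l_pos: "l \<ge> 1"
    and meas: "\<And>i. i < l \<Longrightarrow> p i \<in> borel_measurable M"
    and square_int: "\<And>i. i < l \<Longrightarrow> integrable M (\<lambda>\<omega>. (p i \<omega>)\<^sup>2)"
    and groups: "\<And>k. k < K \<Longrightarrow> G k \<subseteq> {..<l}"
    and cov_invertible: "\<And>k. k < K \<Longrightarrow> invertible_mat (group_cov M p (G k))"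
begin

abbreviation precision :: "nat \<Rightarrow> real mat" where
  "precision k \<equiv> the (mat_inverse (group_cov M p (G k)))"

abbreviation restr :: "nat \<Rightarrow> real mat" where
  "restr k \<equiv> restriction_mat l (G k)"

lemma group_cov_carrier: "group_cov M p S \<in> carrier_mat (card S) (card S)"
  by (simp add: group_cov_def covariance_mat_def)

lemma precision_carrier: "k < K \<Longrightarrow> precision k \<in> carrier_mat (card (G k)) (card (G k))"
  using mat_inverse_of_invertible(1) group_cov_carrier cov_invertible by blast

lemma precision_psd: "k < K \<Longrightarrow> psd_mat (precision k)"
  using mat_inverse_psd(1)[OF psd_group_cov group_cov_carrier cov_invertible]
    groups meas square_int by blast

lemma precision_definite:
  "k < K \<Longrightarrow> x \<in> carrier_vec (card (G k)) \<Longrightarrow> x \<bullet> (precision k *\<^sub>v x) = 0 \<Longrightarrow> x = 0\<^sub>v (card (G k))"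
  using mat_inverse_psd(2)[OF psd_group_cov group_cov_carrier cov_invertible]
    groups meas square_int by blast

lemma Psi_quadratic_form:
  assumes x: "x \<in> carrier_vec l"
  shows "x \<bullet> (Psi M p l G K n *\<^sub>v x) =
    (\<Sum>k<K. n $ k * ((restr k *\<^sub>v x) \<bullet> (precision k *\<^sub>v (restr k *\<^sub>v x))))"
proof -
  let ?A = "\<lambda>k. (restr k)\<^sup>T * precision k * restr k"
  have A: "?A k \<in> carrier_mat l l" if "k < K" for k
    using that by (intro congruence_carrier[OF restriction_mat_carrier precision_carrier] groups)
  have form: "x \<bullet> (?A k *\<^sub>v x) = (\<Sum>i<l. \<Sum>j<l. x $ i * x $ j * ?A k $$ (i, j))"
    if k: "k < K" for k
  proof -
    have "?A k = mat l l (\<lambda>(i, j). ?A k $$ (i, j))" using A[OF k] by (intro eq_matI) auto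
    then show ?thesis using mat_quadratic_form[OF x, of "\<lambda>i j. ?A k $$ (i, j)"] by simp
  qed
  have "x \<bullet> (Psi M p l G K n *\<^sub>v x) =
      (\<Sum>i<l. \<Sum>j<l. \<Sum>k<K. n $ k * (x $ i * x $ j * ?A k $$ (i, j)))"
    unfolding Psi_def mat_quadratic_form[OF x] by (simp add: sum_distrib_left mult_ac)
  also have "\<dots> = (\<Sum>i<l. \<Sum>k<K. \<Sum>j<l. n $ k * (x $ i * x $ j * ?A k $$ (i, j)))"
    by (rule sum.cong[OF refl]) (rule sum.swap)
  also have "\<dots> = (\<Sum>k<K. \<Sum>i<l. \<Sum>j<l. n $ k * (x $ i * x $ j * ?A k $$ (i, j)))"
    by (rule sum.swap)
  also have "\<dots> = (\<Sum>k<K. n $ k * (x \<bullet> (?A k *\<^sub>v x)))"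
    by (intro sum.cong refl) (simp add: form sum_distrib_left)
  also have "\<dots> = (\<Sum>k<K. n $ k * ((restr k *\<^sub>v x) \<bullet> (precision k *\<^sub>v (restr k *\<^sub>v x))))"
    using x groups by (intro sum.cong refl)
      (simp add: congruence_quadratic_form[OF restriction_mat_carrier precision_carrier])
  finally show ?thesis .
qed

lemma precision_form_nonneg:
  assumes "k < K" "x \<in> carrier_vec l"
  shows "(restr k *\<^sub>v x) \<bullet> (precision k *\<^sub>v (restr k *\<^sub>v x)) \<ge> 0"
  using assms psd_matD[OF precision_psd precision_carrier] restriction_mat_carrier[OF groups]
  by (metis carrier_matD(1) carrier_vec_dim_vec dim_mult_mat_vec)

lemma Psi_sym: "(Psi M p l G K n)\<^sup>T = Psi M p l G K n"
proof -
  let ?A = "\<lambda>k. (restr k)\<^sup>T * precision k * restr k"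
  have "?A k $$ (j, i) = ?A k $$ (i, j)" if k: "k < K" and ij: "i < l" "j < l" for i j k
  proof -
    let ?m = "card (G k)"
    have R: "restr k \<in> carrier_mat ?m l" by (rule restriction_mat_carrier[OF groups[OF k]])
    have B: "precision k \<in> carrier_mat ?m ?m" by (rule precision_carrier[OF k])
    have RT: "(restr k)\<^sup>T \<in> carrier_mat l ?m" using R by simp
    have "(?A k)\<^sup>T = (restr k)\<^sup>T * ((restr k)\<^sup>T * precision k)\<^sup>T"
      by (rule transpose_mult[OF mult_carrier_mat[OF RT B] R])
    also have "\<dots> = (restr k)\<^sup>T * (precision k * restr k)"
      using transpose_mult[OF RT B] psd_mat_sym[OF precision_psd[OF k]] by simp
    also have "\<dots> = ?A k" by (rule assoc_mult_mat[OF RT B R, symmetric])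
    finally have "(?A k)\<^sup>T = ?A k" .
    moreover have "?A k \<in> carrier_mat l l" by (rule congruence_carrier[OF R B])
    ultimately show ?thesis using ij by (metis carrier_matD index_transpose_mat(1))
  qed
  then show ?thesis by (intro eq_matI) (auto simp: Psi_def intro!: sum.cong)
qed

lemma Psi_psd:
  assumes "n \<in> carrier_vec K" "0\<^sub>v K \<le> n"
  shows "psd_mat (Psi M p l G K n)"
proof -
  have "n $ k \<ge> 0" if "k < K" for k using assms that by (auto simp: less_eq_vec_def)
  then have "x \<bullet> (Psi M p l G K n *\<^sub>v x) \<ge> 0" if "x \<in> carrier_vec l" for x
    unfolding Psi_quadratic_form[OF that] using that precision_form_nonneg
    by (intro sum_nonneg mult_nonneg_nonneg) auto
  then show ?thesis using Psi_carrier Psi_sym by (intro psd_matI)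
qed

text \<open>
  Some group \<open>k\<close> with the high-fidelity model has \<open>n\<^sub>k > 0\<close>. On the kernel of \<open>\<Psi>\<close> all the nonnegative
  summands of the quadratic form vanish; the one of group \<open>k\<close> is definite in \<open>R\<^sub>k x\<close>, so \<open>x\<^sub>0 = 0\<close>, that
  is, the unit vector is orthogonal to the kernel.
\<close>

lemma unit_vec_in_range_Psi:
  assumes n: "n \<in> carrier_vec K" "0\<^sub>v K \<le> n" and hf: "n \<bullet> hf_vec G K \<ge> 1"
  shows "\<exists>w\<in>carrier_vec l. Psi M p l G K n *\<^sub>v w = unit_vec l 0"
proof (rule symmetric_system_solvable[OF Psi_carrier Psi_sym])
  have nonneg: "n $ k \<ge> 0" if "k < K" for k using n that by (auto simp: less_eq_vec_def)
  have "\<exists>k<K. 0 \<in> G k \<and> n $ k \<noteq> 0"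
  proof (rule ccontr)
    assume "\<not> ?thesis"
    then have "n \<bullet> hf_vec G K = 0"
      using n by (auto simp: scalar_prod_def hf_vec_def intro!: sum.neutral)
    then show False using hf by simp
  qed
  then obtain k where k: "k < K" "0 \<in> G k" "n $ k \<noteq> 0" by blast
  fix x assume x: "x \<in> carrier_vec l" and "Psi M p l G K n *\<^sub>v x = 0\<^sub>v l"
  then have "(\<Sum>k<K. n $ k * ((restr k *\<^sub>v x) \<bullet> (precision k *\<^sub>v (restr k *\<^sub>v x)))) = 0"
    using Psi_quadratic_form[OF x, of n] by simp
  then have "n $ k * ((restr k *\<^sub>v x) \<bullet> (precision k *\<^sub>v (restr k *\<^sub>v x))) = 0"
    using k(1) nonneg precision_form_nonneg[OF _ x] by (subst (asm) sum_nonneg_eq_0_iff) auto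
  then have "(restr k *\<^sub>v x) \<bullet> (precision k *\<^sub>v (restr k *\<^sub>v x)) = 0" using k by simp
  moreover have "restr k *\<^sub>v x \<in> carrier_vec (card (G k))"
    using restriction_mat_carrier[OF groups[OF k(1)]] by simp
  ultimately have "restr k *\<^sub>v x = 0\<^sub>v (card (G k))" using precision_definite[OF k(1)] by blast
  then have "x $ 0 = 0" using restriction_mat_mult_vec_eq_0[OF groups[OF k(1)] x] k(2) by blast
  then show "unit_vec l 0 \<bullet> x = 0" using x l_pos by simp
qed simp

lemma Phi_psd_iff:
  assumes n: "n \<in> carrier_vec K" "0\<^sub>v K \<le> n" and hf: "n \<bullet> hf_vec G K \<ge> 1"
  shows "psd_mat (Phi M p l G K t n) \<longleftrightarrow> objective_A M p l G K n \<le> t"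
proof -
  obtain w where w: "w \<in> carrier_vec l" and e: "Psi M p l G K n *\<^sub>v w = unit_vec l 0"
    using unit_vec_in_range_Psi[OF assms] by blast
  have "objective_A M p l G K n = w \<bullet> (Psi M p l G K n *\<^sub>v w)"
    using pseudo_inverse_quadratic_form[OF Psi_carrier Psi_sym w, of n] by (simp add: e objective_A_def)
  then show ?thesis
    unfolding Phi_def using psd_schur_complement[OF Psi_psd[OF n] Psi_carrier w e] by simp
qed

lemma feasible_B_eq_epigraph:
  "feasible_B M p l G K c b = {(t, n). n \<in> feasible_A G K c b \<and> objective_A M p l G K n \<le> t}"
  unfolding feasible_B_def feasible_A_def using Phi_psd_iff by auto

end

section \<open>Minimization over an epigraph\<close>

lemma INF_epigraph:
  fixes f :: "'b \<Rightarrow> real"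
  shows "(INF x \<in> S. ereal (f x)) = (INF (t, x) \<in> {(t, x). x \<in> S \<and> f x \<le> t}. ereal t)"
proof (rule antisym)
  show "(INF x \<in> S. ereal (f x)) \<le> (INF (t, x) \<in> {(t, x). x \<in> S \<and> f x \<le> t}. ereal t)"
  proof (rule INF_greatest, clarify)
    fix t x assume "x \<in> S" "f x \<le> t"
    then show "(INF x \<in> S. ereal (f x)) \<le> ereal t" by (intro INF_lower2[of x]) auto
  qed
  show "(INF (t, x) \<in> {(t, x). x \<in> S \<and> f x \<le> t}. ereal t) \<le> (INF x \<in> S. ereal (f x))"
  proof (rule INF_greatest)
    fix x assume "x \<in> S"
    then show "(INF (t, x) \<in> {(t, x). x \<in> S \<and> f x \<le> t}. ereal t) \<le> ereal (f x)"
      by (intro INF_lower2[of "(f x, x)"]) auto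
  qed
qed

lemma is_arg_min_epigraph:
  fixes f :: "'b \<Rightarrow> real"
  shows "is_arg_min f (\<lambda>x. x \<in> S) x \<longleftrightarrow>
    (\<exists>t. is_arg_min fst (\<lambda>y. y \<in> {(t, x). x \<in> S \<and> f x \<le> t}) (t, x))"
proof
  assume "is_arg_min f (\<lambda>x. x \<in> S) x"
  then have "is_arg_min fst (\<lambda>y. y \<in> {(t, x). x \<in> S \<and> f x \<le> t}) (f x, x)"
    by (force simp: is_arg_min_def)
  then show "\<exists>t. is_arg_min fst (\<lambda>y. y \<in> {(t, x). x \<in> S \<and> f x \<le> t}) (t, x)" ..
next
  assume "\<exists>t. is_arg_min fst (\<lambda>y. y \<in> {(t, x). x \<in> S \<and> f x \<le> t}) (t, x)"
  then show "is_arg_min f (\<lambda>x. x \<in> S) x"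
    by (force simp: is_arg_min_def)
qed

theorem theorem3p3:
  fixes M :: "'a measure" and p :: "nat \<Rightarrow> 'a \<Rightarrow> real" and l K :: nat
    and G :: "nat \<Rightarrow> nat set" and c :: "real vec" and b :: real
  assumes "prob_space M"
    and "l \<ge> 1"
    and "\<And>i. i < l \<Longrightarrow> p i \<in> borel_measurable M"
    and "\<And>i. i < l \<Longrightarrow> integrable M (\<lambda>\<omega>. (p i \<omega>)\<^sup>2)"
    and "\<And>k. k < K \<Longrightarrow> G k \<subseteq> {..<l} \<and> G k \<noteq> {}"
    and "inj_on G {..<K}"
    and "c \<in> carrier_vec K"
    and "b > 0"
    and "\<And>k. k < K \<Longrightarrow> invertible_mat (group_cov M p (G k))"
  shows "(INF n \<in> feasible_A G K c b. ereal (objective_A M p l G K n))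
       = (INF (t, n) \<in> feasible_B M p l G K c b. ereal t)
    \<and> (\<forall>n. is_arg_min (objective_A M p l G K) (\<lambda>n. n \<in> feasible_A G K c b) n
         \<longleftrightarrow> (\<exists>t. is_arg_min fst (\<lambda>x. x \<in> feasible_B M p l G K c b) (t, n)))"
proof -
  interpret prob_space M by fact
  interpret model_groups M p l K G
    using assms by unfold_locales auto
  show ?thesis
    unfolding feasible_B_eq_epigraph
    by (intro conjI allI INF_epigraph is_arg_min_epigraph)
qed

end
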